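(* Let $n\ge 4$ be an even integer, let $(P_n)$ be the quadratic program in the variables $(x,y)=(x_1,\dots,x_{n-3},y_1,\dots,y_{n-3})\in\mathbb{R}^{2(n-3)}$ defined in the context, and let $G=\langle\sigma\rangle$ be the group of substitutions generated by the substitution $\sigma$ defined in the context. Then $(P_n)$ is invariant under $G$: for every $g\in G$, a point $(x,y)$ satisfies all the constraints of $(P_n)$ if and only if $g(x,y)$ does, and the objective function satisfies $A_n(g(x,y))=A_n(x,y)$.
   Context: Let $n\ge 4$ be even. Given real variables $x_1,\dots,x_{n-3}$ and $y_1,\dots,y_{n-3}$, define for $k=0,1,\dots,\frac n2-2$ the points of $\mathbb{R}^2$ $$u_k=\Big(x_1+\sum_{i=1}^k(-1)^i x_{2i},\; y_1+\sum_{i=1}^k(-1)^i y_{2i}\Big),\qquad w_k=\Big(\sum_{i=0}^k(-1)^{i+1}x_{2i+1},\; \sum_{i=0}^k(-1)^i y_{2i+1}\Big).$$ Define points $v_1,\dots,v_n\in\mathbb{R}^2$, with coordinates written $v_i=(\overline{x}_i,\overline{y}_i)$, by $v_n=(0,0)$, $v_{n/2}=(0,1)$, and $$v_i=u_{2i-1},\quad v_{n-i}=w_{2i-1}\qquad \text{for } i=1,\dots,\lfloor\tfrac{n-2}{4}\rfloor,$$ $$v_{\frac n2-i}=w_{2(i-1)},\quad v_{\frac n2+i}=u_{2(i-1)}\qquad \text{for } i=1,\dots,\lceil\tfrac{n-2}{4}\rceil.$$ Thus every $\overline{x}_i$ is a linear function of $x_1,\dots,x_{n-3}$, and every $\overline{y}_i$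 with $i\ne n/2$ is a linear function of $y_1,\dots,y_{n-3}$. The program $(P_n)$ is: maximize over $(x,y)$ the objective $$A_n(x,y)=x_1+\frac12\sum_{\substack{1\le i\le n-2\\ i\ne \frac n2-1,\; i\neq \frac n2}}\big(\overline{y}_i\,\overline{x}_{i+1}-\overline{x}_i\,\overline{y}_{i+1}\big)$$ subject to the constraints - $\|v_i-v_j\|^2\le 1$ for all $i,j=1,\dots,n$; - $\|v_{\lfloor n/4\rfloor}-v_{\lceil 3n/4\rceil}\|^2=1$; - $x_i^2+y_i^2=1$ for $i=1,\dots,n-3$; - $y_i\ge 0$ for $i=1,\dots,n-3$; - $0\le x_1\le \frac12$; - $0\le x_i\le 1$ for $i=1,\dots,n-3$. Here $\|\cdot\|$ is the Euclidean norm on $\mathbb{R}^2$. The substitution $\sigma$ exchanges $x_{2i}$ with $x_{2i+1}$, and simultaneously exchanges $y_{2i}$ with $y_{2i+1}$, for every $i=1,\dots,\frac n2-2$, and it fixes $x_1$ and $y_1$. It acts on points $(x,y)\in\mathbb{R}^{2(n-3)}$ by the corresponding permutation of coordinates (for $n=4$ it is the identity). *)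

theory Defs
  imports "HOL-Analysis.Analysis" "HOL-Algebra.Bij" "HOL-Algebra.Generated_Groups"
begin

text \<open>A point of the space of dimension \<open>2 * (n - 3)\<close> is a pair \<open>(x, y)\<close> of real vectors indexed by
  \<open>{1..n - 3}\<close>, each rendered as an extensional function, so that equality of pairs is
  equality of points.\<close>

type_synonym point = "(nat \<Rightarrow> real) \<times> (nat \<Rightarrow> real)"

definition points :: "nat \<Rightarrow> point set" where
  "points n = ({1..n - 3} \<rightarrow>\<^sub>E UNIV) \<times> ({1..n - 3} \<rightarrow>\<^sub>E UNIV)"

text \<open>The norm of \<open>real \<times> real\<close> is the Euclidean norm of \<open>\<real>\<^sup>2\<close> (\<open>norm_Pair\<close>).\<close>

definition u_pt :: "(nat \<Rightarrow> real) \<Rightarrow> (nat \<Rightarrow> real) \<Rightarrow> nat \<Rightarrow> real \<times> real" where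
  "u_pt x y k = (x 1 + (\<Sum>i=1..k. (-1) ^ i * x (2 * i)),
              y 1 + (\<Sum>i=1..k. (-1) ^ i * y (2 * i)))"

definition w_pt :: "(nat \<Rightarrow> real) \<Rightarrow> (nat \<Rightarrow> real) \<Rightarrow> nat \<Rightarrow> real \<times> real" where
  "w_pt x y k = ((\<Sum>i=0..k. (-1) ^ (i + 1) * x (2 * i + 1)),
              (\<Sum>i=0..k. (-1) ^ i * y (2 * i + 1)))"

text \<open>The vertices \<open>v\<^sub>1, \<dots>, v\<^sub>n\<close>, by cases on the index; the lemmas \<open>vertex_low\<close>
  and \<open>vertex_mid\<close> below show that for even \<open>n \<ge> 4\<close> this is the assignment
  \<open>v\<^sub>i = u\<^sub>2\<^sub>i\<^sub>-\<^sub>1\<close>, \<open>v\<^sub>n\<^sub>-\<^sub>i = w\<^sub>2\<^sub>i\<^sub>-\<^sub>1\<close> for \<open>1 \<le> i \<le> \<lfloor>(n - 2) / 4\<rfloor>\<close> and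
  \<open>v\<^sub>n\<^sub>/\<^sub>2\<^sub>-\<^sub>i = w\<^sub>2\<^sub>(\<^sub>i\<^sub>-\<^sub>1\<^sub>)\<close>, \<open>v\<^sub>n\<^sub>/\<^sub>2\<^sub>+\<^sub>i = u\<^sub>2\<^sub>(\<^sub>i\<^sub>-\<^sub>1\<^sub>)\<close> for \<open>1 \<le> i \<le> \<lceil>(n - 2) / 4\<rceil>\<close>.\<close>

definition vertex :: "nat \<Rightarrow> (nat \<Rightarrow> real) \<Rightarrow> (nat \<Rightarrow> real) \<Rightarrow> nat \<Rightarrow> real \<times> real" where
  "vertex n x y i =
    (if i = n then (0, 0)
     else if i = n div 2 then (0, 1)
     else if i \<le> (n - 2) div 4 then u_pt x y (2 * i - 1)
     else if n - i \<le> (n - 2) div 4 then w_pt x y (2 * (n - i) - 1)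
     else if i < n div 2 then w_pt x y (2 * (n div 2 - i - 1))
     else u_pt x y (2 * (i - n div 2 - 1)))"

lemma vertex_fixed:
  assumes "even n" "n \<ge> 4"
  shows "vertex n x y n = (0, 0)" and "vertex n x y (n div 2) = (0, 1)"
  using assms by (auto simp: vertex_def)

lemma vertex_low:
  assumes "even n" "n \<ge> 4" "i \<in> {1..nat \<lfloor>real (n - 2) / 4\<rfloor>}"
  shows "vertex n x y i = u_pt x y (2 * i - 1)"
    and "vertex n x y (n - i) = w_pt x y (2 * i - 1)"
proof -
  have "nat \<lfloor>real (n - 2) / 4\<rfloor> = (n - 2) div 4"
    using floor_divide_of_nat_eq[of "n - 2" 4, where 'a = real] by simp
  then have i: "1 \<le> i" "i \<le> (n - 2) div 4" using assms(3) by auto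
  have "i < n div 2" "n - i \<noteq> n" "n - i > n div 2" "n - i > (n - 2) div 4" "n - (n - i) = i"
    using i assms(1,2) by auto
  with i show "vertex n x y i = u_pt x y (2 * i - 1)"
    and "vertex n x y (n - i) = w_pt x y (2 * i - 1)"
    by (auto simp: vertex_def)
qed

lemma vertex_mid:
  assumes "even n" "n \<ge> 4" "i \<in> {1..nat \<lceil>real (n - 2) / 4\<rceil>}"
  shows "vertex n x y (n div 2 - i) = w_pt x y (2 * (i - 1))"
    and "vertex n x y (n div 2 + i) = u_pt x y (2 * (i - 1))"
proof -
  from assms(1) obtain m where m: "n = 2 * m" by blast
  have "real i \<le> real_of_int \<lceil>real (n - 2) / 4\<rceil>" using assms(3) by auto
  then have "real i < real (n - 2) / 4 + 1" by linarith
  then have "real (4 * i) < real (n + 2)" using assms(2) by (simp add: of_nat_diff field_simps)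
  then have *: "4 * i < n + 2" by linarith
  then have i: "1 \<le> i" "2 * i < m + 1" using assms(3) m by auto
  have "(n - 2) div 4 < m - i" "n - (m + i) = m - i" "i < m" "m - i < m" "m + i < n"
    using i m assms(2) by auto
  then show "vertex n x y (n div 2 - i) = w_pt x y (2 * (i - 1))"
    and "vertex n x y (n div 2 + i) = u_pt x y (2 * (i - 1))"
    using i m by (auto simp: vertex_def)
qed

fun feasible :: "nat \<Rightarrow> point \<Rightarrow> bool" where
  "feasible n (x, y) \<longleftrightarrow>
     (\<forall>i\<in>{1..n}. \<forall>j\<in>{1..n}. (norm (vertex n x y i - vertex n x y j))\<^sup>2 \<le> 1) \<and>
     (norm (vertex n x y (nat \<lfloor>real n / 4\<rfloor>) - vertex n x y (nat \<lceil>3 * real n / 4\<rceil>)))\<^sup>2 = 1 \<and>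
     (\<forall>i\<in>{1..n - 3}. (x i)\<^sup>2 + (y i)\<^sup>2 = 1) \<and>
     (\<forall>i\<in>{1..n - 3}. 0 \<le> y i) \<and>
     0 \<le> x 1 \<and> x 1 \<le> 1 / 2 \<and>
     (\<forall>i\<in>{1..n - 3}. 0 \<le> x i \<and> x i \<le> 1)"

fun objective :: "nat \<Rightarrow> point \<Rightarrow> real" where
  "objective n (x, y) =
     x 1 + 1 / 2 * (\<Sum>i | i \<in> {1..n - 2} \<and> i \<noteq> n div 2 - 1 \<and> i \<noteq> n div 2.
       snd (vertex n x y i) * fst (vertex n x y (i + 1))
       - fst (vertex n x y i) * snd (vertex n x y (i + 1)))"

datatype var = X nat | Y nat

definition vars :: "nat \<Rightarrow> var set" where
  "vars n = X ` {1..n - 3} \<union> Y ` {1..n - 3}"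

text \<open>On indices, \<open>\<sigma>\<close> exchanges \<open>2 * i\<close> and \<open>2 * i + 1\<close> for \<open>1 \<le> i \<le> n / 2 - 2\<close> and fixes \<open>1\<close>;
  as \<open>n\<close> is even, \<open>n - 3\<close> is odd and \<open>{2..n - 3}\<close> is the union of these pairs.\<close>

definition swap_index :: "nat \<Rightarrow> nat" where
  "swap_index j = (if j \<le> 1 then j else if even j then j + 1 else j - 1)"

definition sigma :: "nat \<Rightarrow> var \<Rightarrow> var" where
  "sigma n = (\<lambda>a\<in>vars n. case a of X j \<Rightarrow> X (swap_index j) | Y j \<Rightarrow> Y (swap_index j))"

lemma sigma_fixed:
  assumes "n \<ge> 4"
  shows "sigma n (X 1) = X 1" and "sigma n (Y 1) = Y 1"
  using assms by (auto simp: sigma_def vars_def swap_index_def)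

lemma sigma_swap:
  assumes "even n" "i \<in> {1..n div 2 - 2}"
  shows "sigma n (X (2 * i)) = X (2 * i + 1)" and "sigma n (X (2 * i + 1)) = X (2 * i)"
    and "sigma n (Y (2 * i)) = Y (2 * i + 1)" and "sigma n (Y (2 * i + 1)) = Y (2 * i)"
  using assms by (auto simp: sigma_def vars_def swap_index_def)

lemma sigma_in_BijGroup:
  assumes "even n" "n \<ge> 4"
  shows "sigma n \<in> carrier (BijGroup (vars n))"
proof -
  have idx: "swap_index j \<in> {1..n - 3}" if "j \<in> {1..n - 3}" for j
  proof -
    from assms(1) obtain m where "n = 2 * m" by blast
    then show ?thesis
      using that assms(2) by (auto simp: swap_index_def elim!: evenE) presburger
  qed
  have idem: "swap_index (swap_index j) = j" for j
    by (auto simp: swap_index_def elim: oddE)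
  have "bij_betw (sigma n) (vars n) (vars n)"
    by (rule bij_betw_byWitness[where f' = "sigma n"])
      (use idx in \<open>auto simp: sigma_def vars_def idem image_iff\<close>)
  then show ?thesis
    by (simp add: BijGroup_def Bij_def sigma_def)
qed

definition subst_group :: "nat \<Rightarrow> (var \<Rightarrow> var) set" where
  "subst_group n = generate (BijGroup (vars n)) {sigma n}"

fun coord :: "point \<Rightarrow> var \<Rightarrow> real" where
  "coord (x, y) (X i) = x i"
| "coord (x, y) (Y i) = y i"

text \<open>Substituting the variable \<open>g a\<close> for every variable \<open>a\<close> in a function of \<open>(x, y)\<close> amounts
  to evaluating that function at \<open>act n g (x, y)\<close>.\<close>

definition act :: "nat \<Rightarrow> (var \<Rightarrow> var) \<Rightarrow> point \<Rightarrow> point" where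
  "act n g p = (\<lambda>i\<in>{1..n - 3}. coord p (g (X i)), \<lambda>i\<in>{1..n - 3}. coord p (g (Y i)))"

end

theory Submission imports Defs begin

text \<open>Up to the reflection \<open>(a, b) \<mapsto> (-a, b)\<close>, the substitution \<open>\<sigma>\<close> exchanges \<open>u\<^sub>k\<close> and \<open>w\<^sub>k\<close>, hence
  \<open>v\<^sub>i\<close> and \<open>v\<^sub>n\<^sub>-\<^sub>i\<close>. Distances are preserved, and since the reflection and the reversal of the
  cyclic order both change the sign of a determinant, the term of index \<open>i\<close> of the objective
  becomes the term of index \<open>n - 1 - i\<close>. As \<open>\<sigma>\<close> is an involution, the group is \<open>{1, \<sigma>}\<close>.\<close>

definition reflect :: "real \<times> real \<Rightarrow> real \<times> real" where
  "reflect p = (- fst p, snd p)"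

lemma fst_reflect [simp]: "fst (reflect p) = - fst p"
  and snd_reflect [simp]: "snd (reflect p) = snd p"
  by (simp_all add: reflect_def)

lemma norm_reflect_diff: "norm (reflect p - reflect q) = norm (p - q)"
  by (cases p; cases q) (simp add: reflect_def norm_Pair power2_commute)

text \<open>The action of \<open>sigma n\<close> on one half of a point; it permutes the
  \<open>x\<close> and \<open>y\<close> alike. The restriction keeps the result extensional, so that
  two swaps give back the same function.\<close>

definition swap_vec :: "nat \<Rightarrow> (nat \<Rightarrow> real) \<Rightarrow> nat \<Rightarrow> real" where
  "swap_vec n x = (\<lambda>i\<in>{1..n - 3}. x (swap_index i))"

lemma swap_index_in:
  assumes "even n" "n \<ge> 4" "i \<in> {1..n - 3}"
  shows "swap_index i \<in> {1..n - 3}"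
proof -
  from assms(1) obtain m where "n = 2 * m" by blast
  then show ?thesis
    using assms(2,3) by (auto simp: swap_index_def elim!: evenE) presburger
qed

lemma swap_index_swap_index [simp]: "swap_index (swap_index i) = i"
  by (auto simp: swap_index_def elim: oddE)

lemma swap_vec_1: "n \<ge> 4 \<Longrightarrow> swap_vec n x (Suc 0) = x (Suc 0)"
  by (auto simp: swap_vec_def swap_index_def)

text \<open>The bound on \<open>k\<close> gives \<open>2 * k + 1\<close> \<le> \<open>n - 3\<close>,
  so every index lies where \<open>swap_vec\<close> is not \<open>undefined\<close>.\<close>

lemma swap_vec_even_odd:
  assumes "n \<ge> 4" "k \<le> n div 2 - 2"
  shows "i \<in> {1..k} \<Longrightarrow> swap_vec n x (2 * i) = x (2 * i + 1)"
    and "i \<in> {1..k} \<Longrightarrow> swap_vec n x (2 * i + 1) = x (2 * i)"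
  using assms by (auto simp: swap_vec_def swap_index_def)

lemma swap_vec_swap_vec:
  assumes "even n" "n \<ge> 4" "x \<in> {1..n - 3} \<rightarrow>\<^sub>E UNIV"
  shows "swap_vec n (swap_vec n x) = x"
proof
  fix i
  show "swap_vec n (swap_vec n x) i = x i"
  proof (cases "i \<in> {1..n - 3}")
    case True
    then show ?thesis
      using swap_index_in[OF assms(1,2) True] by (simp add: swap_vec_def)
  next
    case False
    then show ?thesis
      using assms(3) by (auto simp: swap_vec_def PiE_def extensional_def)
  qed
qed

text \<open>With the term at 0 split off, \<open>w_pt\<close> has the shape of \<open>u_pt\<close>
  with odd variables in place of even ones and the first coordinate negated.\<close>

lemma w_pt_split:
  "w_pt x y k = (- x 1 + (\<Sum>i=1..k. (-1) ^ (i + 1) * x (2 * i + 1)),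
                 y 1 + (\<Sum>i=1..k. (-1) ^ i * y (2 * i + 1)))"
  by (simp add: w_pt_def sum.atLeast_Suc_atMost)

lemma u_pt_swap_vec:
  assumes "n \<ge> 4" "k \<le> n div 2 - 2"
  shows "u_pt (swap_vec n x) (swap_vec n y) k = reflect (w_pt x y k)"
proof -
  have "(\<Sum>i=1..k. (-1) ^ i * swap_vec n z (2 * i)) = (\<Sum>i=1..k. (-1) ^ i * z (2 * i + 1))" for z
    using swap_vec_even_odd(1)[OF assms] by (intro sum.cong) auto
  then show ?thesis
    by (simp add: u_pt_def w_pt_split reflect_def swap_vec_1[OF assms(1)] sum_negf)
qed

lemma w_pt_swap_vec:
  assumes "n \<ge> 4" "k \<le> n div 2 - 2"
  shows "w_pt (swap_vec n x) (swap_vec n y) k = reflect (u_pt x y k)"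
proof -
  have "(\<Sum>i=1..k. (-1) ^ i * swap_vec n z (2 * i + 1)) = (\<Sum>i=1..k. (-1) ^ i * z (2 * i))" for z
    using swap_vec_even_odd(2)[OF assms] by (intro sum.cong) auto
  then show ?thesis
    by (simp add: u_pt_def w_pt_split reflect_def swap_vec_1[OF assms(1)] sum_negf)
qed

text \<open>The index \<open>n\<close> stands apart: \<open>n - n\<close> is 0, which numbers no
  vertex. The origin is fixed by the reflection.\<close>

lemma vertex_swap_vec_n:
  "vertex n (swap_vec n x) (swap_vec n y) n = reflect (vertex n x y n)"
  by (simp add: vertex_def reflect_def)

lemma vertex_swap_vec:
  assumes "even n" "n \<ge> 4" "i \<in> {1..n - 1}"
  shows "vertex n (swap_vec n x) (swap_vec n y) i = reflect (vertex n x y (n - i))"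
proof -
  obtain m where n: "n = 2 * m" using assms(1) by blast
  have i: "1 \<le> i" "i < n" and m: "m \<ge> 2" using assms n by auto
  \<comment> \<open>These are the branches of \<open>vertex\<close>. The map from \<open>i\<close>
    to \<open>n - i\<close> pairs each \<open>u_pt\<close> branch with a \<open>w_pt\<close> branch
    at the same argument, and fixes \<open>m\<close>, whose vertex lies on the axis of
    reflection.\<close>
  consider "i = m" | "i \<le> (n - 2) div 4" | "n - i \<le> (n - 2) div 4"
    | "i > (n - 2) div 4" "i < m" | "n - i > (n - 2) div 4" "i > m"
    by linarith
  then show ?thesis
  proof cases
    case 1
    then show ?thesis using n m by (simp add: vertex_def reflect_def)
  next
    case 2
    then have "2 * i - 1 \<le> n div 2 - 2" "i < m" using n m i by auto
    with 2 show ?thesis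
      using n m i u_pt_swap_vec[OF assms(2), of "2 * i - 1"] by (auto simp: vertex_def)
  next
    case 3
    then have "2 * (n - i) - 1 \<le> n div 2 - 2" "n - i < m" using n m i by auto
    with 3 show ?thesis
      using n m i w_pt_swap_vec[OF assms(2), of "2 * (n - i) - 1"] by (auto simp: vertex_def)
  next
    case 4
    then have "2 * (m - i - 1) \<le> n div 2 - 2" using n m i by auto
    moreover have "n - i - m - 1 = m - i - 1" using n by auto
    ultimately show ?thesis
      using 4 n m i w_pt_swap_vec[OF assms(2), of "2 * (m - i - 1)"] by (auto simp: vertex_def)
  next
    case 5
    then have "2 * (i - m - 1) \<le> n div 2 - 2" using n m i by auto
    moreover have "m - (n - i) - 1 = i - m - 1" using n i by auto
    ultimately show ?thesis
      using 5 n m i u_pt_swap_vec[OF assms(2), of "2 * (i - m - 1)"] by (auto simp: vertex_def)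
  qed
qed

lemma feasible_swap_vec:
  assumes "even n" "n \<ge> 4" "feasible n (x, y)"
  shows "feasible n (swap_vec n x, swap_vec n y)"
proof -
  let ?v = "vertex n x y" and ?v' = "vertex n (swap_vec n x) (swap_vec n y)"
  \<comment> \<open>The distance bounds range over all pairs, so it suffices that each new vertex is
    the reflection of some old one.\<close>
  have v': "\<exists>j\<in>{1..n}. ?v' i = reflect (?v j)" if "i \<in> {1..n}" for i
  proof (cases "i = n")
    case True
    then show ?thesis using vertex_swap_vec_n that by blast
  next
    case False
    then have "i \<in> {1..n - 1}" "n - i \<in> {1..n}" using that by auto
    then show ?thesis using vertex_swap_vec[OF assms(1,2)] by blast
  qed
  have "(norm (?v' i - ?v' j))\<^sup>2 \<le> 1" if "i \<in> {1..n}" "j \<in> {1..n}" for i j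
  proof -
    obtain i' j' where "i' \<in> {1..n}" "j' \<in> {1..n}" "?v' i = reflect (?v i')" "?v' j = reflect (?v j')"
      using v' \<open>i \<in> {1..n}\<close> \<open>j \<in> {1..n}\<close> by meson
    then show ?thesis using assms(3) by (simp add: norm_reflect_diff)
  qed
  moreover have "(norm (?v' (nat \<lfloor>real n / 4\<rfloor>) - ?v' (nat \<lceil>3 * real n / 4\<rceil>)))\<^sup>2 = 1"
  proof -
    define a b where "a = nat \<lfloor>real n / 4\<rfloor>" and "b = nat \<lceil>3 * real n / 4\<rceil>"
    \<comment> \<open>Since 3n/4 = n - n/4, the ceiling is \<open>n\<close> minus the floor of n/4.
      The two distinguished vertices therefore trade places.\<close>
    have "n = a + b"
      unfolding a_def b_def by linarith
    moreover have "1 \<le> a" "1 \<le> b"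
      using assms(2) unfolding a_def b_def by linarith+
    ultimately have ab: "a \<in> {1..n - 1}" "b \<in> {1..n - 1}" "n - a = b" "n - b = a"
      by auto
    have "(norm (?v a - ?v b))\<^sup>2 = 1"
      using assms(3) by (simp add: a_def b_def)
    then show ?thesis
      unfolding a_def[symmetric] b_def[symmetric]
      using ab by (simp add: vertex_swap_vec[OF assms(1,2)] norm_reflect_diff norm_minus_commute)
  qed
  \<comment> \<open>The remaining constraints are uniform over an index range that
    \<open>swap_index\<close> preserves, except the bound 1/2 on \<open>x 1\<close>, and index 1 is
    fixed.\<close>
  moreover have "swap_vec n z i = z (swap_index i)" if "i \<in> {1..n - 3}" for z i
    using that by (simp add: swap_vec_def)
  ultimately show ?thesis
    using assms(3) swap_index_in[OF assms(1,2)] swap_vec_1[OF assms(2)] by simp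
qed

lemma objective_swap_vec:
  assumes "even n" "n \<ge> 4"
  shows "objective n (swap_vec n x, swap_vec n y) = objective n (x, y)"
proof -
  define I where "I = {i. i \<in> {1..n - 2} \<and> i \<noteq> n div 2 - 1 \<and> i \<noteq> n div 2}"
  define T where "T v i = snd (v i) * fst (v (i + 1)) - fst (v i) * snd (v (i + 1))"
    for v :: "nat \<Rightarrow> real \<times> real" and i
  let ?v = "vertex n x y" and ?v' = "vertex n (swap_vec n x) (swap_vec n y)"
  have T: "T ?v' i = T ?v (n - 1 - i)" if "i \<in> {1..n - 2}" for i
  proof -
    have i: "i \<in> {1..n - 1}" "i + 1 \<in> {1..n - 1}" "n - (i + 1) = n - 1 - i" "n - i = n - 1 - i + 1"
      using that assms(2) by auto
    show ?thesis
      unfolding T_def vertex_swap_vec[OF assms i(1)] vertex_swap_vec[OF assms i(2)] i(3,4)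
      by (simp add: mult.commute)
  qed
  obtain m where "n = 2 * m" using assms(1) by blast
  \<comment> \<open>The map from \<open>i\<close> to \<open>n - 1 - i\<close> exchanges the two
    excluded indices \<open>n div 2 - 1\<close> and \<open>n div 2\<close>, hence preserves
    \<open>I\<close>.\<close>
  then have I: "n - 1 - i \<in> I" "n - 1 - (n - 1 - i) = i" if "i \<in> I" for i
    using that assms(2) by (auto simp: I_def)
  have "(\<Sum>i\<in>I. T ?v' i) = (\<Sum>i\<in>I. T ?v i)"
    by (rule sum.reindex_bij_witness[where i = "\<lambda>i. n - 1 - i" and j = "\<lambda>i. n - 1 - i"])
      (use I T in \<open>auto simp: I_def\<close>)
  then show ?thesis
    using swap_vec_1[OF assms(2)] by (simp add: I_def T_def)
qed

lemma sigma_sigma: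
  assumes "even n" "n \<ge> 4"
  shows "sigma n \<otimes>\<^bsub>BijGroup (vars n)\<^esub> sigma n = \<one>\<^bsub>BijGroup (vars n)\<^esub>"
proof -
  have "compose (vars n) (sigma n) (sigma n) = (\<lambda>a\<in>vars n. a)"
    using swap_index_in[OF assms]
    by (auto simp: compose_def sigma_def vars_def fun_eq_iff)
  then show ?thesis
    using sigma_in_BijGroup[OF assms] by (simp add: BijGroup_def)
qed

lemma subst_group_cases:
  assumes "even n" "n \<ge> 4" "g \<in> subst_group n"
  shows "g = \<one>\<^bsub>BijGroup (vars n)\<^esub> \<or> g = sigma n"
proof -
  interpret group "BijGroup (vars n)" by (rule group_BijGroup)
  note s = sigma_in_BijGroup[OF assms(1,2)] and ss = sigma_sigma[OF assms(1,2)]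
  from assms(3)[unfolded subst_group_def] show ?thesis
  proof (induction rule: generate.induct)
    case (inv h)
    then show ?case using inv_equality[OF ss s s] by simp
  next
    case (eng h1 h2)
    then show ?case using s ss by auto
  qed auto
qed

text \<open>The unit is the identity restricted to \<open>vars n\<close>, the only place where
  \<open>act\<close> evaluates it; extensionality of the point settles the other indices.\<close>

lemma act_one:
  assumes "(x, y) \<in> points n"
  shows "act n \<one>\<^bsub>BijGroup (vars n)\<^esub> (x, y) = (x, y)"
  using assms
  by (auto simp: act_def BijGroup_def vars_def points_def PiE_def extensional_def fun_eq_iff)

lemma act_sigma: "act n (sigma n) (x, y) = (swap_vec n x, swap_vec n y)"
  by (auto simp: act_def sigma_def vars_def swap_vec_def fun_eq_iff)

theorem lemma1:
  fixes n :: nat and g :: "var \<Rightarrow> var" and x y :: "nat \<Rightarrow> real"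
  assumes "even n" and "n \<ge> 4"
    and "g \<in> subst_group n"
    and "(x, y) \<in> points n"
  shows "(feasible n (x, y) \<longleftrightarrow> feasible n (act n g (x, y)))
    \<and> objective n (act n g (x, y)) = objective n (x, y)"
  using subst_group_cases[OF assms(1-3)]
proof
  assume "g = \<one>\<^bsub>BijGroup (vars n)\<^esub>"
  then show ?thesis using act_one[OF assms(4)] by simp
next
  assume g: "g = sigma n"
  have "swap_vec n (swap_vec n x) = x" "swap_vec n (swap_vec n y) = y"
    using swap_vec_swap_vec[OF assms(1,2)] assms(4) by (auto simp: points_def)
  \<comment> \<open>The converse is the same implication applied to the swapped point.\<close>
  then have "feasible n (x, y) \<longleftrightarrow> feasible n (swap_vec n x, swap_vec n y)"
    using feasible_swap_vec[OF assms(1,2)] by metis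
  then show ?thesis
    unfolding g act_sigma using objective_swap_vec[OF assms(1,2)] by blast
qed

end
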